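(* Let $\lambda$ be a positive integer with $\gcd(\lambda,6)=1$, and let $a\ge 2$ and $b\ge 0$ be integers. For $n=\lambda\cdot 2^a\cdot 3^b-1$ we have $v_2(3n+1)=1$.
   Context: $v_2(m)$ denotes the 2-adic valuation of a nonzero integer $m$, i.e. the exponent of the largest power of $2$ dividing $m$. *)

theory Defs
  imports "HOL-Computational_Algebra.Primes"
begin

end

theory Submission
  imports Defs
begin

theorem corollary3p7:
  fixes l n :: int and a b :: nat
  assumes "l > 0" and "gcd l 6 = 1" and "a \<ge> 2"
    and "n = l * 2 ^ a * 3 ^ b - 1"
  shows "multiplicity 2 (3 * n + 1) = 1"
proof -
  \<comment> \<open>Since \<open>a \<ge> 2\<close>, \<open>4\<close> divides \<open>n + 1\<close>, so \<open>3 * n + 1 = 3 * (n + 1) - 2\<close> is \<open>2\<close> modulo \<open>4\<close>.\<close>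
  have "(2::int) ^ 2 dvd 2 ^ a"
    using \<open>a \<ge> 2\<close> by (rule le_imp_power_dvd)
  then have "4 dvd n + 1"
    using assms(4) by simp
  then obtain k where "n + 1 = 4 * k" ..
  then have "3 * n + 1 = 2 + 4 * (3 * k - 1)"
    by simp
  then show ?thesis
    by (intro multiplicity_eqI) (simp_all, presburger+)
qed

end
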